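(* Let $k>0$, let $g_{0R},g_{0I},g_{1R},g_{1I}\in\mathbb{R}$, $g_0=g_{0R}+ig_{0I}$, $g_1=g_{1R}+ig_{1I}$, and let $\lambda_1,\lambda_2>0$, $\lambda_3,\lambda_4<0$. Let $f=f_R+if_I$, where $f_R,f_I$ are sufficiently smooth real-valued functions, ensuring that $u_R,u_I$ below are sufficiently smooth. Consider the Helmholtz equation with impedance boundary conditions $$\frac{d^2u}{dx^2}+k^2u=f,\ \ 0<x<1,\qquad u'(0)+iku(0)=g_0,\qquad u'(1)-iku(1)=g_1,\qquad (\mathrm{H})$$ for $u=u_R+iu_I$ with $u_R,u_I$ real-valued, and the initial boundary value problem for the linear hyperbolic system $$\frac{\partial \vec Q}{\partial t}+A\frac{\partial \vec Q}{\partial x}=B\vec Q+\vec F,\quad t>0,$$ $$\vec Q(0,x)=\vec Q_0(x),\ 0<x<1,\qquad B_0\vec Q(t,0)=\vec G_0,\quad B_1\vec Q(t,1)=\vec G_1,\quad t\ge 0,\qquad (\mathrm{P})$$ for the unknown real vector function $\vec Q=(Q_1(t,x),Q_2(t,x),Q_3(t,x),Q_4(t,x))^T$, with $\vec Q_0$ sufficiently smooth and with $A,B,B_0,B_1,\vec F,\vec G_0,\vec G_1$ as given in the context. Then (H) is equivalent to (P) at steady states (i.e. when $\partial Q_i/\partial t=0$ for $i=1,2,3,4$) in the following sense: $$u_R(x)=Q_1(t,x),\quad u_I(x)=Q_2(t,x),\quad \frac{du_R(x)}{dx}=Q_3(t,x),\quad \frac{du_I(x)}{dx}=Q_4(t,x),\qquad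 t\ge 0.$$
   Context: Here $i$ (when not an index) is the imaginary unit. The vectors and matrices are $$\vec G_0=(g_{0R},g_{0I},0,0)^T,\qquad \vec G_1=(0,0,g_{1R},g_{1I})^T,$$ $$B_0=\begin{pmatrix}k&0&1&0\\ 0&k&0&1\\ 0&0&0&0\\ 0&0&0&0\end{pmatrix},\qquad B_1=\begin{pmatrix}0&0&0&0\\ 0&0&0&0\\ 0&k&1&0\\ -k&0&0&1\end{pmatrix},$$ $$\vec F=\frac12\begin{pmatrix}[f_I(\lambda_2-\lambda_4)+f_R(\lambda_1-\lambda_3)]\frac1k\\ [f_I(\lambda_2-\lambda_4)+f_R(\lambda_3-\lambda_1)]\frac1k\\ f_I(\lambda_4-\lambda_2)+f_R(\lambda_1+\lambda_3)\\ f_I(\lambda_2+\lambda_4)+f_R(\lambda_1-\lambda_3)\end{pmatrix},$$ $$A=\frac12\begin{pmatrix}\lambda_1+\lambda_4&\lambda_2-\lambda_3&(\lambda_1-\lambda_3)\frac1k&(\lambda_2-\lambda_4)\frac1k\\ \lambda_4-\lambda_1&\lambda_2+\lambda_3&(\lambda_3-\lambda_1)\frac1k&(\lambda_2-\lambda_4)\frac1k\\ (\lambda_1-\lambda_4)k&(\lambda_3-\lambda_2)k&\lambda_1+\lambda_3&\lambda_4-\lambda_2\\ (\lambda_1-\lambda_4)k&(\lambda_2-\lambda_3)k&\lambda_1-\lambda_3&\lambda_4+\lambda_2\end{pmatrix},$$ $$B=\frac12\begin{pmatrix}(\lambda_3-\lambda_1)k&(\lambda_4-\lambda_2)k&\lambda_1+\lambda_4&\lambda_2-\lambda_3\\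 (\lambda_1-\lambda_3)k&(\lambda_4-\lambda_2)k&\lambda_4-\lambda_1&\lambda_2+\lambda_3\\ -(\lambda_1+\lambda_3)k^2&(\lambda_2-\lambda_4)k^2&(\lambda_1-\lambda_4)k&(\lambda_3-\lambda_2)k\\ (\lambda_3-\lambda_1)k^2&-(\lambda_2+\lambda_4)k^2&(\lambda_1-\lambda_4)k&(\lambda_2-\lambda_3)k\end{pmatrix}.$$
   Formalization: The first two rows of B_0 are corrected to (0,-k,1,0) and (k,0,0,1), matching u'(0)+iku(0)=g_0; with the printed rows (k,0,1,0), (0,k,0,1) the claim fails, e.g. for u=1, f=k^2, g_0=ik, g_1=-ik. *)

theory Defs
  imports "HOL-Analysis.Analysis"
begin

text \<open>
  Derivatives on closed sets are taken within the set, so they are one-sided at the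
  end points of \<open>[0,1]\<close> and at \<open>t = 0\<close>.
\<close>

definition C1_unit :: "(real \<Rightarrow> 'a::real_normed_vector) \<Rightarrow> bool" where
  "C1_unit v \<longleftrightarrow>
     (\<exists>v'. continuous_on {0..1} v' \<and>
           (\<forall>x\<in>{0..1}. (v has_vector_derivative v' x) (at x within {0..1})))"

text \<open>The Helmholtz impedance problem (H), for classical solutions \<open>u \<in> C\<^sup>2([0,1])\<close>.\<close>

definition helmholtz_solution ::
  "real \<Rightarrow> (real \<Rightarrow> complex) \<Rightarrow> complex \<Rightarrow> complex \<Rightarrow> (real \<Rightarrow> complex) \<Rightarrow> bool" where
  "helmholtz_solution k f g0 g1 u \<longleftrightarrow>
     (\<exists>u' u''.
        (\<forall>x\<in>{0..1}. (u has_vector_derivative u' x) (at x within {0..1})) \<and>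
        (\<forall>x\<in>{0..1}. (u' has_vector_derivative u'' x) (at x within {0..1})) \<and>
        continuous_on {0..1} u'' \<and>
        (\<forall>x\<in>{0<..<1}. u'' x + (complex_of_real k)\<^sup>2 * u x = f x) \<and>
        u' 0 + \<i> * complex_of_real k * u 0 = g0 \<and>
        u' 1 - \<i> * complex_of_real k * u 1 = g1)"

text \<open>The initial boundary value problem (P), for classical solutions \<open>Q \<in> C\<^sup>1([0,\<infinity>) \<times> [0,1])\<close>; the arguments of
  \<open>Q\<close> are \<open>t\<close> and \<open>x\<close>, in this order.\<close>

definition ibvp_solution ::
  "real^4^4 \<Rightarrow> real^4^4 \<Rightarrow> (real \<Rightarrow> real^4) \<Rightarrow> real^4^4 \<Rightarrow> real^4^4 \<Rightarrow> real^4 \<Rightarrow> real^4 \<Rightarrow>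
   (real \<Rightarrow> real^4) \<Rightarrow> (real \<Rightarrow> real \<Rightarrow> real^4) \<Rightarrow> bool" where
  "ibvp_solution A B F B0 B1 G0 G1 Q0 Q \<longleftrightarrow>
     (\<exists>Qt Qx.
        continuous_on ({0..} \<times> {0..1}) (\<lambda>(t, x). Qt t x) \<and>
        continuous_on ({0..} \<times> {0..1}) (\<lambda>(t, x). Qx t x) \<and>
        (\<forall>t\<ge>0. \<forall>x\<in>{0..1}.
           ((\<lambda>s. Q s x) has_vector_derivative Qt t x) (at t within {0..}) \<and>
           ((\<lambda>y. Q t y) has_vector_derivative Qx t x) (at x within {0..1})) \<and>
        (\<forall>t>0. \<forall>x\<in>{0<..<1}. Qt t x + A *v Qx t x = B *v Q t x + F x)) \<and>
     (\<forall>x\<in>{0<..<1}. Q 0 x = Q0 x) \<and>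
     (\<forall>t\<ge>0. B0 *v Q t 0 = G0) \<and>
     (\<forall>t\<ge>0. B1 *v Q t 1 = G1)"

definition steady_state :: "(real \<Rightarrow> real \<Rightarrow> real^4) \<Rightarrow> bool" where
  "steady_state Q \<longleftrightarrow>
     (\<forall>i. \<forall>t\<ge>0. \<forall>x\<in>{0..1}. ((\<lambda>s. Q s x $ i) has_real_derivative 0) (at t within {0..}))"

definition corresponds :: "(real \<Rightarrow> complex) \<Rightarrow> (real \<Rightarrow> real \<Rightarrow> real^4) \<Rightarrow> bool" where
  "corresponds u Q \<longleftrightarrow>
     (\<forall>t\<ge>0. \<forall>x\<in>{0..1}.
        Re (u x) = Q t x $ 1 \<and>
        Im (u x) = Q t x $ 2 \<and>
        ((\<lambda>y. Re (u y)) has_real_derivative Q t x $ 3) (at x within {0..1}) \<and>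
        ((\<lambda>y. Im (u y)) has_real_derivative Q t x $ 4) (at x within {0..1}))"

definition G0_vec :: "real \<Rightarrow> real \<Rightarrow> real^4" where
  "G0_vec g0R g0I = vector [g0R, g0I, 0, 0]"

definition G1_vec :: "real \<Rightarrow> real \<Rightarrow> real^4" where
  "G1_vec g1R g1I = vector [0, 0, g1R, g1I]"

text \<open>
  The upper two rows are the real and imaginary parts of \<open>u'(0) + \<i> k u(0)\<close> in terms of
  \<open>(u\<^sub>R, u\<^sub>I, u\<^sub>R', u\<^sub>I')\<close>.  The source prints them as \<open>(k, 0, 1, 0)\<close> and
  \<open>(0, k, 0, 1)\<close>, which is the condition \<open>u'(0) + k u(0) = g\<^sub>0\<close> without the imaginary unit;
  with those rows the equivalence is false.  For instance, \<open>u = 1\<close> solves (H) with \<open>f = k\<^sup>2\<close>,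
  \<open>g\<^sub>0 = \<i> k\<close>, \<open>g\<^sub>1 = - \<i> k\<close>, but \<open>Q = (1, 0, 0, 0)\<close> would violate the condition at
  \<open>x = 0\<close>.
\<close>

definition B0_mat :: "real \<Rightarrow> real^4^4" where
  "B0_mat k = vector [
     vector [0, - k, 1, 0],
     vector [k,   0, 0, 1],
     vector [0,   0, 0, 0],
     vector [0,   0, 0, 0]]"

definition B1_mat :: "real \<Rightarrow> real^4^4" where
  "B1_mat k = vector [
     vector [  0, 0, 0, 0],
     vector [  0, 0, 0, 0],
     vector [  0, k, 1, 0],
     vector [- k, 0, 0, 1]]"

definition F_vec ::
  "real \<Rightarrow> real \<Rightarrow> real \<Rightarrow> real \<Rightarrow> real \<Rightarrow> (real \<Rightarrow> real) \<Rightarrow> (real \<Rightarrow> real) \<Rightarrow> real \<Rightarrow> real^4" where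
  "F_vec k l1 l2 l3 l4 fR fI x = (1/2) *\<^sub>R vector [
     (fI x * (l2 - l4) + fR x * (l1 - l3)) * (1/k),
     (fI x * (l2 - l4) + fR x * (l3 - l1)) * (1/k),
     fI x * (l4 - l2) + fR x * (l1 + l3),
     fI x * (l2 + l4) + fR x * (l1 - l3)]"

definition A_mat :: "real \<Rightarrow> real \<Rightarrow> real \<Rightarrow> real \<Rightarrow> real \<Rightarrow> real^4^4" where
  "A_mat k l1 l2 l3 l4 = (1/2) *\<^sub>R vector [
     vector [l1 + l4,       l2 - l3,       (l1 - l3) * (1/k), (l2 - l4) * (1/k)],
     vector [l4 - l1,       l2 + l3,       (l3 - l1) * (1/k), (l2 - l4) * (1/k)],
     vector [(l1 - l4) * k, (l3 - l2) * k, l1 + l3,           l4 - l2],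
     vector [(l1 - l4) * k, (l2 - l3) * k, l1 - l3,           l4 + l2]]"

definition B_mat :: "real \<Rightarrow> real \<Rightarrow> real \<Rightarrow> real \<Rightarrow> real \<Rightarrow> real^4^4" where
  "B_mat k l1 l2 l3 l4 = (1/2) *\<^sub>R vector [
     vector [(l3 - l1) * k,       (l4 - l2) * k,       l1 + l4,       l2 - l3],
     vector [(l1 - l3) * k,       (l4 - l2) * k,       l4 - l1,       l2 + l3],
     vector [- (l1 + l3) * k\<^sup>2,   (l2 - l4) * k\<^sup>2,     (l1 - l4) * k, (l3 - l2) * k],
     vector [(l3 - l1) * k\<^sup>2,     - (l2 + l4) * k\<^sup>2,   (l1 - l4) * k, (l2 - l3) * k]]"

definition problem_P ::
  "real \<Rightarrow> real \<Rightarrow> real \<Rightarrow> real \<Rightarrow> real \<Rightarrow> (real \<Rightarrow> real) \<Rightarrow> (real \<Rightarrow> real) \<Rightarrow>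
   real \<Rightarrow> real \<Rightarrow> real \<Rightarrow> real \<Rightarrow>
   (real \<Rightarrow> real^4) \<Rightarrow> (real \<Rightarrow> real \<Rightarrow> real^4) \<Rightarrow> bool" where
  "problem_P k l1 l2 l3 l4 fR fI g0R g0I g1R g1I =
     ibvp_solution (A_mat k l1 l2 l3 l4) (B_mat k l1 l2 l3 l4) (F_vec k l1 l2 l3 l4 fR fI)
       (B0_mat k) (B1_mat k) (G0_vec g0R g0I) (G1_vec g1R g1I)"

end

theory Submission
  imports Defs
begin

text \<open>
  Put \<open>q = (Re u, Im u, Re u', Im u')\<close>.  With \<open>M\<close> the companion matrix of \<open>u'' + k\<^sup>2 u = 0\<close> acting on
  \<open>q\<close>, one has \<open>B = A M\<close> and \<open>F = A (0, 0, f\<^sub>R, f\<^sub>I)\<close>.  Since \<open>A\<close> is invertible (its eigenvalues are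
  \<open>\<lambda>\<^sub>1, \<dots>, \<lambda>\<^sub>4\<close>), the steady equation \<open>A q' = B q + F\<close> says exactly \<open>q' = M q + (0, 0, f\<^sub>R, f\<^sub>I)\<close>, which is the
  Helmholtz equation in first-order form.
\<close>

section \<open>Coordinates on \<open>real^4\<close> and pairs of complex numbers\<close>

lemma vector_4 [simp]:
  fixes a b c d :: "'a::zero"
  shows "(vector [a, b, c, d] :: 'a^4) $ 1 = a"
    and "(vector [a, b, c, d] :: 'a^4) $ 2 = b"
    and "(vector [a, b, c, d] :: 'a^4) $ 3 = c"
    and "(vector [a, b, c, d] :: 'a^4) $ 4 = d"
  unfolding vector_def by simp_all

lemma vec_eq_iff_4: "(v :: 'a^4) = w \<longleftrightarrow> v $ 1 = w $ 1 \<and> v $ 2 = w $ 2 \<and> v $ 3 = w $ 3 \<and> v $ 4 = w $ 4"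
  by (simp add: vec_eq_iff forall_4)

lemma has_vector_derivative_vec_iff:
  fixes f :: "real \<Rightarrow> real^'n"
  shows "(f has_vector_derivative f') F \<longleftrightarrow> (\<forall>i. ((\<lambda>x. f x $ i) has_vector_derivative f' $ i) F)"
proof
  assume "(f has_vector_derivative f') F"
  then show "\<forall>i. ((\<lambda>x. f x $ i) has_vector_derivative f' $ i) F"
    using bounded_linear.has_vector_derivative[OF bounded_linear_vec_nth] by blast
next
  assume h: "\<forall>i. ((\<lambda>x. f x $ i) has_vector_derivative f' $ i) F"
  \<comment> \<open>The components are reassembled along the standard basis; a finite sum of fixed
    vectors with differentiable coefficients can be differentiated termwise.\<close>
  have "((\<lambda>x. \<Sum>i\<in>UNIV. f x $ i *\<^sub>R axis i (1::real)) has_vector_derivative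
      (\<Sum>i\<in>UNIV. f' $ i *\<^sub>R axis i 1)) F"
    using h by (intro has_vector_derivative_sum
      bounded_linear.has_vector_derivative[OF bounded_linear_scaleR_left]) auto
  then show "(f has_vector_derivative f') F"
    using basis_expansion[where 'a=real and 'n='n] by (simp add: scalar_mult_eq_scaleR)
qed

text \<open>Identifies C^2 with R^4, so that the real system can be treated as a complex first-order
  system for the pair (u, u').\<close>

definition phase :: "complex \<Rightarrow> complex \<Rightarrow> real^4" where
  "phase z w = vector [Re z, Im z, Re w, Im w]"

lemma phase_nth [simp]:
  "phase z w $ 1 = Re z" "phase z w $ 2 = Im z" "phase z w $ 3 = Re w" "phase z w $ 4 = Im w"
  by (simp_all add: phase_def)

lemma phase_Complex: "phase (Complex (v $ 1) (v $ 2)) (Complex (v $ 3) (v $ 4)) = v"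
  by (simp add: vec_eq_iff_4)

lemma has_vector_derivative_phase_iff:
  "((\<lambda>x. phase (a x) (b x)) has_vector_derivative phase a' b') F \<longleftrightarrow>
     (a has_vector_derivative a') F \<and> (b has_vector_derivative b') F"
  by (auto simp: has_vector_derivative_vec_iff has_vector_derivative_complex_iff forall_4
      has_real_derivative_iff_has_vector_derivative)

lemma continuous_on_phase [continuous_intros]:
  assumes "continuous_on S a" "continuous_on S b"
  shows "continuous_on S (\<lambda>x. phase (a x) (b x))"
proof -
  have "continuous_on S (\<lambda>x. phase (a x) (b x) $ i)" for i
    using exhaust_4[of i] assms by (elim disjE) (simp_all add: continuous_on_Re continuous_on_Im)
  then have "continuous_on S (\<lambda>x. \<chi> i. phase (a x) (b x) $ i)"
    by (rule continuous_on_vec_lambda)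
  then show ?thesis by simp
qed

section \<open>Algebra of the coefficient and boundary matrices\<close>

lemma steady_equation_iff:
  fixes k l1 l2 l3 l4 :: real
  assumes "k \<noteq> 0" "l1 \<noteq> 0" "l2 \<noteq> 0" "l3 \<noteq> 0" "l4 \<noteq> 0"
  shows "A_mat k l1 l2 l3 l4 *v phase z' w' = B_mat k l1 l2 l3 l4 *v phase z w + F_vec k l1 l2 l3 l4 fR fI x
     \<longleftrightarrow> z' = w \<and> w' + (complex_of_real k)\<^sup>2 * z = Complex (fR x) (fI x)" (is "?L \<longleftrightarrow> ?R")
proof -
  let ?A = "A_mat k l1 l2 l3 l4"
  \<comment> \<open>This is the value that the Helmholtz equation prescribes for w'. The steady
    equation then compares two images under the same matrix \<open>?A\<close>.\<close>
  let ?w = "Complex (fR x) (fI x) - (complex_of_real k)\<^sup>2 * z"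
  note unfold = matrix_vector_mult_def sum_4 vec_eq_iff_4
  have rhs: "B_mat k l1 l2 l3 l4 *v phase z w + F_vec k l1 l2 l3 l4 fR fI x = ?A *v phase w ?w"
    using \<open>k \<noteq> 0\<close>
    by (simp add: unfold A_mat_def B_mat_def F_vec_def power2_eq_square)
       (simp add: field_simps)
  have inj: "v = 0" if "?A *v v = 0" for v
  proof -
    \<comment> \<open>Dividing the last two components by \<open>k\<close> makes \<open>k\<close>
      disappear from the upper two rows of \<open>?A\<close> and leaves it as a common factor of the
      lower two.\<close>
    define a b c d where "a = v $ 1" "b = v $ 2" "c = v $ 3 / k" "d = v $ 4 / k"
    have v: "v $ 1 = a" "v $ 2 = b" "v $ 3 = k * c" "v $ 4 = k * d"
      using \<open>k \<noteq> 0\<close> by (simp_all add: a_b_c_d_def)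
    \<comment> \<open>\<open>a + c\<close>, \<open>b + d\<close>, \<open>b + c\<close>, \<open>a - d\<close> are the characteristic variables of the system.\<close>
    define X Y Z W where "X = l1 * (a + c)" "Y = l2 * (b + d)" "Z = l3 * (b + c)" "W = l4 * (a - d)"
    have "?A *v v = (1/2) *\<^sub>R vector
        [X + Y - Z + W, - X + Y + Z + W, k * (X - Y + Z - W), k * (X + Y - Z - W)]"
      using \<open>k \<noteq> 0\<close>
      by (simp add: unfold A_mat_def v X_Y_Z_W_def) (simp add: field_simps)
    with that have "X + Y - Z + W = 0" "- X + Y + Z + W = 0" "X - Y + Z - W = 0" "X + Y - Z - W = 0"
      using \<open>k \<noteq> 0\<close> by (simp_all add: vec_eq_iff_4)
    then have "X = 0" "Y = 0" "Z = 0" "W = 0"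
      by linarith+
    then have "a + c = 0" "b + d = 0" "b + c = 0" "a - d = 0"
      using assms by (simp_all add: X_Y_Z_W_def)
    \<comment> \<open>The chain a = -c = b = -d = -a forces a = 0, and the others follow.\<close>
    then have "a = 0" "b = 0" "c = 0" "d = 0" by auto
    then show "v = 0" by (simp add: vec_eq_iff_4 v)
  qed
  have "?L \<longleftrightarrow> ?A *v (phase z' w' - phase w ?w) = 0"
    by (simp add: rhs matrix_vector_mult_diff_distrib)
  also have "\<dots> \<longleftrightarrow> phase z' w' = phase w ?w"
    using inj[of "phase z' w' - phase w ?w"] by auto
  also have "\<dots> \<longleftrightarrow> ?R"
    by (auto simp: vec_eq_iff_4 complex_eq_iff)
  finally show ?thesis .
qed

text \<open>Multiplication by \<open>\<i> k\<close> sends (Re z, Im z) to (-k Im z, k Re z), which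
  gives the nonzero rows; the zero rows read 0 = 0. The right boundary works in the same way with
  the opposite sign.\<close>

lemma left_boundary_iff:
  "B0_mat k *v phase z w = G0_vec a b \<longleftrightarrow> w + \<i> * complex_of_real k * z = Complex a b"
  by (simp add: matrix_vector_mult_def sum_4 vec_eq_iff_4 B0_mat_def G0_vec_def complex_eq_iff add.commute)

lemma right_boundary_iff:
  "B1_mat k *v phase z w = G1_vec a b \<longleftrightarrow> w - \<i> * complex_of_real k * z = Complex a b"
  by (simp add: matrix_vector_mult_def sum_4 vec_eq_iff_4 B1_mat_def G1_vec_def complex_eq_iff add.commute)

section \<open>Correspondence, steadiness and passage to the end points\<close>

lemma vector_derivative_unique_unit_interval:
  assumes "x \<in> {0..1::real}"
    and "(f has_vector_derivative a) (at x within {0..1})"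
    and "(f has_vector_derivative b) (at x within {0..1})"
  shows "a = b"
  using vector_derivative_unique_within_closed_interval[of 0 1 x f a b] assms
  by (simp add: cbox_interval)

text \<open>The last two components of \<open>Q\<close> are derivatives of a function of x alone.
  Uniqueness of derivatives within the interval, end points included, makes them independent of t,
  so one u' serves all times.\<close>

lemma corresponds_iff:
  "corresponds u Q \<longleftrightarrow>
     (\<exists>u'. \<forall>x\<in>{0..1}. (u has_vector_derivative u' x) (at x within {0..1}) \<and>
        (\<forall>t\<ge>0. Q t x = phase (u x) (u' x)))" (is "?L \<longleftrightarrow> ?R")
proof
  assume L: ?L
  define w where "w t x = Complex (Q t x $ 3) (Q t x $ 4)" for t x
  have der: "(u has_vector_derivative w t x) (at x within {0..1})"
    and Q: "Q t x = phase (u x) (w t x)" if "t \<ge> 0" "x \<in> {0..1}" for t x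
  proof -
    have "Re (u x) = Q t x $ 1" "Im (u x) = Q t x $ 2"
      "((\<lambda>y. Re (u y)) has_real_derivative Q t x $ 3) (at x within {0..1})"
      "((\<lambda>y. Im (u y)) has_real_derivative Q t x $ 4) (at x within {0..1})"
      using L that unfolding corresponds_def by blast+
    then show "(u has_vector_derivative w t x) (at x within {0..1})" "Q t x = phase (u x) (w t x)"
      by (simp_all add: w_def has_vector_derivative_complex_iff vec_eq_iff_4)
  qed
  have "Q t x = phase (u x) (w 0 x)" if "t \<ge> 0" "x \<in> {0..1}" for t x
  proof -
    have "w t x = w 0 x"
      by (rule vector_derivative_unique_unit_interval[OF that(2) der[OF that] der[OF order_refl that(2)]])
    then show ?thesis using Q[OF that] by simp
  qed
  with der[OF order_refl] have "\<forall>x\<in>{0..1}. (u has_vector_derivative w 0 x) (at x within {0..1}) \<and>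
      (\<forall>t\<ge>0. Q t x = phase (u x) (w 0 x))"
    by blast
  then show ?R by blast
next
  assume ?R
  then obtain u' where
    der: "\<And>x. x \<in> {0..1} \<Longrightarrow> (u has_vector_derivative u' x) (at x within {0..1})"
    and Q: "\<And>t x. t \<ge> 0 \<Longrightarrow> x \<in> {0..1} \<Longrightarrow> Q t x = phase (u x) (u' x)"
    by blast
  then show ?L
    by (simp add: corresponds_def has_vector_derivative_complex_iff)
qed

lemma steady_state_iff_constant:
  "steady_state Q \<longleftrightarrow> (\<forall>t\<ge>0. \<forall>x\<in>{0..1}. Q t x = Q 0 x)"
proof (intro iffI allI ballI impI)
  fix t x :: real
  assume st: "steady_state Q" and tx: "0 \<le> t" "x \<in> {0..1}"
  have "((\<lambda>s. Q s x) has_vector_derivative 0) (at s within {0..})" if "s \<in> {0..}" for s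
    using st that tx by (auto simp: steady_state_def has_vector_derivative_vec_iff
        has_real_derivative_iff_has_vector_derivative)
  then obtain c where "\<And>s. s \<in> {0..} \<Longrightarrow> Q s x = c"
    using has_vector_derivative_zero_constant[OF convex_real_interval(1)] by blast
  then show "Q t x = Q 0 x" using tx by auto
next
  assume "\<forall>t\<ge>0. \<forall>x\<in>{0..1}. Q t x = Q 0 x"
  then have const: "Q 0 x = Q t x" if "t \<ge> 0" "x \<in> {0..1}" for t x
    using that by metis
  have "((\<lambda>s. Q s x $ i) has_real_derivative 0) (at t within {0..})"
    if "t \<ge> 0" "x \<in> {0..1}" for t x i
    \<comment> \<open>The final \<open>1\<close> is the radius of the neighbourhood of comparison;
      any positive number works, since the two functions agree on all of
      \<open>{0..}\<close>.\<close>
    by (rule has_field_derivative_transform_within[of "\<lambda>_. Q 0 x $ i" _ _ _ 1])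
      (use const that in auto)
  then show "steady_state Q" by (simp add: steady_state_def)
qed

text \<open>The equation of a classical solution holds only for \<open>0 < x < 1\<close>; this carries it to the end points.\<close>

lemma continuous_on_eq_interior:
  fixes g h :: "real \<Rightarrow> 'a::real_normed_vector"
  assumes "continuous_on {0..1} g" "continuous_on {0..1} h"
    and "\<And>x. x \<in> {0<..<1} \<Longrightarrow> g x = h x" and "x \<in> {0..1}"
  shows "g x = h x"
  using continuous_constant_on_closure[of "{0<..<1}" "\<lambda>x. g x - h x" 0 x] assms
  by (simp add: closure_greaterThanLessThan continuous_on_diff)

section \<open>From the Helmholtz problem to the hyperbolic system\<close>

lemma helmholtz_imp_problem_P:
  assumes nz: "k \<noteq> 0" "l1 \<noteq> 0" "l2 \<noteq> 0" "l3 \<noteq> 0" "l4 \<noteq> 0"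
    and H: "helmholtz_solution k (\<lambda>x. Complex (fR x) (fI x)) (Complex g0R g0I) (Complex g1R g1I) u"
    and cor: "corresponds u Q"
  shows "(\<exists>Q0. C1_unit Q0 \<and> problem_P k l1 l2 l3 l4 fR fI g0R g0I g1R g1I Q0 Q) \<and> steady_state Q"
proof -
  obtain u' u'' where
      u': "\<And>x. x \<in> {0..1} \<Longrightarrow> (u has_vector_derivative u' x) (at x within {0..1})"
    and u'': "\<And>x. x \<in> {0..1} \<Longrightarrow> (u' has_vector_derivative u'' x) (at x within {0..1})"
    and cont: "continuous_on {0..1} u''"
    and eq: "\<And>x. x \<in> {0<..<1} \<Longrightarrow> u'' x + (complex_of_real k)\<^sup>2 * u x = Complex (fR x) (fI x)"
    and bc: "u' 0 + \<i> * complex_of_real k * u 0 = Complex g0R g0I"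
      "u' 1 - \<i> * complex_of_real k * u 1 = Complex g1R g1I"
    using H unfolding helmholtz_solution_def by blast
  obtain w where w: "\<And>x. x \<in> {0..1} \<Longrightarrow> (u has_vector_derivative w x) (at x within {0..1})"
    and Qw: "\<And>t x. t \<ge> 0 \<Longrightarrow> x \<in> {0..1} \<Longrightarrow> Q t x = phase (u x) (w x)"
    using cor unfolding corresponds_iff by blast
  have "w x = u' x" if "x \<in> {0..1}" for x
    using vector_derivative_unique_unit_interval[OF that w[OF that] u'[OF that]] .
  then have Q: "Q t x = phase (u x) (u' x)" if "t \<ge> 0" "x \<in> {0..1}" for t x
    using Qw that by simp
  \<comment> \<open>\<open>V\<close> is the steady profile and also serves as the initial datum. Its
    derivative \<open>V'\<close> is continuous because u is twice continuously
    differentiable.\<close>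
  define V V' where "V x = phase (u x) (u' x)" and "V' x = phase (u' x) (u'' x)" for x
  have cont': "continuous_on {0..1} u'"
    using u'' by (rule continuous_on_vector_derivative)
  have contV': "continuous_on {0..1} V'"
    unfolding V'_def by (intro continuous_intros cont cont')
  have derV: "(V has_vector_derivative V' x) (at x within {0..1})" if "x \<in> {0..1}" for x
    using u' u'' that unfolding V_def V'_def has_vector_derivative_phase_iff by blast
  have "C1_unit V"
    using contV' derV unfolding C1_unit_def by blast
  moreover have "problem_P k l1 l2 l3 l4 fR fI g0R g0I g1R g1I V Q"
    unfolding problem_P_def ibvp_solution_def
  \<comment> \<open>\<open>Q\<close> equals \<open>V\<close> at every time, so the witnesses are 0
    for the t-derivative and \<open>V'\<close> for the x-derivative.\<close>
  proof ((rule conjI, rule exI[of _ "\<lambda>_ _. 0"], rule exI[of _ "\<lambda>_. V'"]); intro conjI allI impI ballI)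
    show "continuous_on ({0..} \<times> {0..1}) (\<lambda>(t::real, x::real). 0::real^4)"
      by (simp add: case_prod_beta)
    show "continuous_on ({0..} \<times> {0..1}) (\<lambda>(t::real, x). V' x)"
      unfolding case_prod_beta
      by (rule continuous_on_compose2[OF contV']) (auto intro!: continuous_intros)
    show "((\<lambda>s. Q s x) has_vector_derivative 0) (at t within {0..})"
      if "0 \<le> t" "x \<in> {0..1}" for t x
      by (rule has_vector_derivative_transform[of _ _ _ "\<lambda>_. V x"])
        (use that Q V_def in auto)
    show "(Q t has_vector_derivative V' x) (at x within {0..1})"
      if "0 \<le> t" "x \<in> {0..1}" for t x
      by (rule has_vector_derivative_transform[of _ _ _ V])
        (use that Q V_def derV in auto)
    show "0 + A_mat k l1 l2 l3 l4 *v V' x =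
        B_mat k l1 l2 l3 l4 *v Q t x + F_vec k l1 l2 l3 l4 fR fI x"
      if "0 < t" "x \<in> {0<..<1}" for t x
      using that Q[of t x] eq[of x] by (simp add: V'_def steady_equation_iff[OF nz])
    show "B0_mat k *v Q t 0 = G0_vec g0R g0I" if "0 \<le> t" for t
      using that Q[of t 0] bc by (simp add: left_boundary_iff)
    show "B1_mat k *v Q t 1 = G1_vec g1R g1I" if "0 \<le> t" for t
      using that Q[of t 1] bc by (simp add: right_boundary_iff)
    show "Q 0 x = V x" if "x \<in> {0<..<1}" for x
      using that Q[of 0 x] by (simp add: V_def)
  qed
  moreover have "steady_state Q"
    using Q by (simp add: steady_state_iff_constant)
  ultimately show ?thesis by blast
qed

section \<open>From steady states back to the Helmholtz problem\<close>

text \<open>A steady \<open>Q\<close> is determined by its profile at a single time. Inverting the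
  matrix of the system there splits the equation into z' = w and the second-order equation.\<close>

lemma steady_problem_P_first_order:
  assumes nz: "k \<noteq> 0" "l1 \<noteq> 0" "l2 \<noteq> 0" "l3 \<noteq> 0" "l4 \<noteq> 0"
    and P: "problem_P k l1 l2 l3 l4 fR fI g0R g0I g1R g1I Q0 Q"
    and st: "steady_state Q"
  obtains z w w' where
    "\<And>t x. t \<ge> 0 \<Longrightarrow> x \<in> {0..1} \<Longrightarrow> Q t x = phase (z x) (w x)"
    "\<And>x. x \<in> {0..1} \<Longrightarrow> (z has_vector_derivative w x) (at x within {0..1})"
    "\<And>x. x \<in> {0..1} \<Longrightarrow> (w has_vector_derivative w' x) (at x within {0..1})"
    "continuous_on {0..1} w'"
    "\<And>x. x \<in> {0<..<1} \<Longrightarrow> w' x + (complex_of_real k)\<^sup>2 * z x = Complex (fR x) (fI x)"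
    "w 0 + \<i> * complex_of_real k * z 0 = Complex g0R g0I"
    "w 1 - \<i> * complex_of_real k * z 1 = Complex g1R g1I"
proof -
  obtain Qt Qx where
      contQx: "continuous_on ({0..} \<times> {0..1}) (\<lambda>(t, x). Qx t x)"
    and der: "\<forall>t\<ge>0. \<forall>x\<in>{0..1}.
        ((\<lambda>s. Q s x) has_vector_derivative Qt t x) (at t within {0..}) \<and>
        (Q t has_vector_derivative Qx t x) (at x within {0..1})"
    and pde: "\<forall>t>0. \<forall>x\<in>{0<..<1}. Qt t x + A_mat k l1 l2 l3 l4 *v Qx t x
        = B_mat k l1 l2 l3 l4 *v Q t x + F_vec k l1 l2 l3 l4 fR fI x"
    and left: "\<forall>t\<ge>0. B0_mat k *v Q t 0 = G0_vec g0R g0I"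
    and right: "\<forall>t\<ge>0. B1_mat k *v Q t 1 = G1_vec g1R g1I"
    using P unfolding problem_P_def ibvp_solution_def by (elim conjE exE) (rule that)
  \<comment> \<open>The profile is read off at t = 1 because the differential equation is given only
    for t > 0; any positive time would do.\<close>
  have derQt: "((\<lambda>s. Q s x) has_vector_derivative Qt 1 x) (at 1 within {0..})"
    and derQx: "(Q 1 has_vector_derivative Qx 1 x) (at x within {0..1})" if "x \<in> {0..1}" for x
    using der that zero_le_one by blast+
  have const: "Q 1 x = Q t x" if "t \<ge> 0" "x \<in> {0..1}" for t x
  proof -
    have "Q 1 x = Q 0 x" "Q t x = Q 0 x"
      using st that zero_le_one unfolding steady_state_iff_constant by blast+
    then show ?thesis by simp
  qed
  define z w z' w' where "z x = Complex (Q 1 x $ 1) (Q 1 x $ 2)"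
    and "w x = Complex (Q 1 x $ 3) (Q 1 x $ 4)"
    and "z' x = Complex (Qx 1 x $ 1) (Qx 1 x $ 2)"
    and "w' x = Complex (Qx 1 x $ 3) (Qx 1 x $ 4)" for x
  have Q1: "Q 1 x = phase (z x) (w x)" and Qx1: "Qx 1 x = phase (z' x) (w' x)" for x
    by (simp_all add: z_def w_def z'_def w'_def phase_Complex)
  have "Q 1 = (\<lambda>x. phase (z x) (w x))"
    using Q1 by blast
  then have der: "(z has_vector_derivative z' x) (at x within {0..1})"
    "(w has_vector_derivative w' x) (at x within {0..1})" if "x \<in> {0..1}" for x
    using derQx[OF that] by (simp_all add: Qx1 has_vector_derivative_phase_iff)
  have "continuous_on {0..1} (\<lambda>x. (\<lambda>(t, x). Qx t x) (1, x))"
    by (rule continuous_on_compose2[OF contQx]) (auto intro!: continuous_intros)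
  then have contQx1: "continuous_on {0..1} (Qx 1)" by simp
  have cont: "continuous_on {0..1} z'" "continuous_on {0..1} w'"
    unfolding z'_def w'_def by (intro continuous_on_Complex continuous_on_component contQx1)+
  have contw: "continuous_on {0..1} w"
    using der by (intro continuous_on_vector_derivative) auto
  have eq: "z' x = w x" "w' x + (complex_of_real k)\<^sup>2 * z x = Complex (fR x) (fI x)"
    if x: "x \<in> {0<..<1}" for x
  proof -
    have x': "x \<in> {0..1}" using x by simp
    have steady: "((\<lambda>s. Q s x) has_vector_derivative 0) (at 1 within {0..})"
    proof (rule has_vector_derivative_transform[of _ _ _ "\<lambda>_. Q 1 x"])
      show "Q s x = Q 1 x" if "s \<in> {0..}" for s
        using const[of s x] x' that by simp
    qed simp_all
    \<comment> \<open>Nontriviality of this filter makes the t-derivative unique, so the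
      \<open>Qt\<close> supplied by the solution must vanish at t = 1.\<close>
    have "at (1::real) within {0..} \<noteq> bot"
      using at_within_interior[of "1::real" "{0..}"] by simp
    then have "Qt 1 x = 0"
      by (rule vector_derivative_unique_within[OF _ derQt[OF x'] steady])
    then show "z' x = w x" "w' x + (complex_of_real k)\<^sup>2 * z x = Complex (fR x) (fI x)"
      using pde[rule_format, OF zero_less_one x] by (simp_all add: Q1 Qx1 steady_equation_iff[OF nz])
  qed
  \<comment> \<open>At the end points this rests on continuity of both sides. It is needed there
    because the impedance conditions involve \<open>w 0\<close> and \<open>w 1\<close> as
    derivatives of \<open>z\<close>.\<close>
  have z': "z' x = w x" if "x \<in> {0..1}" for x
    by (rule continuous_on_eq_interior[OF cont(1) contw eq(1) that])
  have Q: "Q t x = phase (z x) (w x)" if "t \<ge> 0" "x \<in> {0..1}" for t x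
    using const[OF that] by (simp add: Q1)
  have der_z: "(z has_vector_derivative w x) (at x within {0..1})" if "x \<in> {0..1}" for x
    using der(1)[OF that] z'[OF that] by simp
  have bc: "w 0 + \<i> * complex_of_real k * z 0 = Complex g0R g0I"
    "w 1 - \<i> * complex_of_real k * z 1 = Complex g1R g1I"
    using left[rule_format, OF zero_le_one] right[rule_format, OF zero_le_one]
    by (simp_all add: Q1 left_boundary_iff right_boundary_iff)
  show ?thesis
    by (rule that[OF Q der_z der(2) cont(2) eq(2) bc])
qed

text \<open>The first two components of \<open>Q\<close> fix u on [0,1], though not outside it.
  Since all derivatives are taken within [0,1], the solution property of \<open>z\<close> carries
  over to every corresponding u.\<close>

lemma steady_problem_P_imp_helmholtz:
  assumes nz: "k \<noteq> 0" "l1 \<noteq> 0" "l2 \<noteq> 0" "l3 \<noteq> 0" "l4 \<noteq> 0"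
    and P: "problem_P k l1 l2 l3 l4 fR fI g0R g0I g1R g1I Q0 Q"
    and st: "steady_state Q"
  shows "(\<exists>u. corresponds u Q) \<and> (\<forall>u. corresponds u Q \<longrightarrow>
    helmholtz_solution k (\<lambda>x. Complex (fR x) (fI x)) (Complex g0R g0I) (Complex g1R g1I) u)"
proof -
  obtain z w w' where
      Q: "\<And>t x. t \<ge> 0 \<Longrightarrow> x \<in> {0..1} \<Longrightarrow> Q t x = phase (z x) (w x)"
    and z: "\<And>x. x \<in> {0..1} \<Longrightarrow> (z has_vector_derivative w x) (at x within {0..1})"
    and w: "\<And>x. x \<in> {0..1} \<Longrightarrow> (w has_vector_derivative w' x) (at x within {0..1})"
    and w': "continuous_on {0..1} w'"
      "\<And>x. x \<in> {0<..<1} \<Longrightarrow> w' x + (complex_of_real k)\<^sup>2 * z x = Complex (fR x) (fI x)"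
    and bc: "w 0 + \<i> * complex_of_real k * z 0 = Complex g0R g0I"
      "w 1 - \<i> * complex_of_real k * z 1 = Complex g1R g1I"
    by (rule steady_problem_P_first_order[OF assms]) (rule that)
  have "corresponds z Q"
    using Q z unfolding corresponds_iff by blast
  moreover have "helmholtz_solution k (\<lambda>x. Complex (fR x) (fI x)) (Complex g0R g0I) (Complex g1R g1I) u"
    if cor: "corresponds u Q" for u
  proof -
    have u: "u x = z x" if "x \<in> {0..1}" for x
    proof -
      have "Re (u x) = Q 0 x $ 1" "Im (u x) = Q 0 x $ 2"
        using cor that unfolding corresponds_def by blast+
      then show ?thesis
        using Q[OF order_refl that] by (simp add: complex_eq_iff)
    qed
    have "(u has_vector_derivative w x) (at x within {0..1})" if "x \<in> {0..1}" for x
      by (rule has_vector_derivative_transform[of _ _ _ z]) (use u z that in auto)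
    then show ?thesis
      unfolding helmholtz_solution_def
      using w w' bc u by (intro exI[of _ w] exI[of _ w']) auto
  qed
  ultimately show ?thesis by blast
qed

theorem theorem2p1:
  fixes k g0R g0I g1R g1I l1 l2 l3 l4 :: real
    and fR fI :: "real \<Rightarrow> real"
    and g0 g1 :: complex
    and f :: "real \<Rightarrow> complex"
  assumes "k > 0"
    and "g0 = complex_of_real g0R + \<i> * complex_of_real g0I"
    and "g1 = complex_of_real g1R + \<i> * complex_of_real g1I"
    and "l1 > 0" and "l2 > 0" and "l3 < 0" and "l4 < 0"
    and "f = (\<lambda>x. complex_of_real (fR x) + \<i> * complex_of_real (fI x))"
    and "continuous_on {0..1} fR" and "continuous_on {0..1} fI"
  shows "(\<forall>u. helmholtz_solution k f g0 g1 u \<longrightarrow>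
            (\<exists>Q. corresponds u Q) \<and>
            (\<forall>Q. corresponds u Q \<longrightarrow>
               (\<exists>Q0. C1_unit Q0 \<and> problem_P k l1 l2 l3 l4 fR fI g0R g0I g1R g1I Q0 Q) \<and>
               steady_state Q)) \<and>
         (\<forall>Q0 Q. C1_unit Q0 \<and> problem_P k l1 l2 l3 l4 fR fI g0R g0I g1R g1I Q0 Q \<and>
               steady_state Q \<longrightarrow>
            (\<exists>u. corresponds u Q) \<and>
            (\<forall>u. corresponds u Q \<longrightarrow> helmholtz_solution k f g0 g1 u))"
proof -
  have nz: "k \<noteq> 0" "l1 \<noteq> 0" "l2 \<noteq> 0" "l3 \<noteq> 0" "l4 \<noteq> 0"
    using assms by auto
  have data: "g0 = Complex g0R g0I" "g1 = Complex g1R g1I" "f = (\<lambda>x. Complex (fR x) (fI x))"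
    using assms by (simp_all add: Complex_eq)
  have "\<exists>Q. corresponds u Q" if H: "helmholtz_solution k f g0 g1 u" for u
  proof -
    obtain u' where "\<forall>x\<in>{0..1}. (u has_vector_derivative u' x) (at x within {0..1})"
      using H unfolding helmholtz_solution_def by blast
    \<comment> \<open>The corresponding \<open>Q\<close> repeats the pair (u, u') at every
      time.\<close>
    then show ?thesis
      unfolding corresponds_iff by (intro exI[of _ "\<lambda>t x. phase (u x) (u' x)"] exI[of _ u']) auto
  qed
  then show ?thesis
    using helmholtz_imp_problem_P[OF nz] steady_problem_P_imp_helmholtz[OF nz]
    unfolding data by blast
qed

end
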